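(* Let $\varepsilon$ be a fixed positive constant and let $G = (V,E)$ be an $n$-vertex graph with $m$ edges such that (i) $m \ge \varepsilon^{-2} n$, or (ii) all degrees are at most $\frac{\varepsilon^2 n}{2}$. If $n$ is sufficiently large, then $G$ admits a bisection $V = V_1 \cup V_2$ in which each $V_i$ ($i=1,2$) spans at most $\left(\frac{1}{4} + \varepsilon\right) m$ edges.
   Context: Graphs are finite and simple. A bisection of a graph is a bipartition $V = V_1 \cup V_2$ of its vertex set into disjoint parts with $\big||V_1|-|V_2|\big| \le 1$. The number of edges spanned by $V_i$ is the number of edges with both endpoints in $V_i$.
   Formalization: In alternative (ii) the number of edges m, and not only n, is also required to be sufficiently large in terms of ε; without this, a triangle with many isolated vertices is a counterexample for ε < 1/12. *)

theory Defs
  imports Complex_Main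
begin

definition simple_graph :: "'a set \<Rightarrow> 'a set set \<Rightarrow> bool" where
  "simple_graph V E \<longleftrightarrow> finite V \<and> (\<forall>e\<in>E. e \<subseteq> V \<and> card e = 2)"

definition vertex_degree :: "'a set set \<Rightarrow> 'a \<Rightarrow> nat" where
  "vertex_degree E v = card {e \<in> E. v \<in> e}"

definition spanned_edges :: "'a set set \<Rightarrow> 'a set \<Rightarrow> 'a set set" where
  "spanned_edges E W = {e \<in> E. e \<subseteq> W}"

(* The difference is taken in int, since subtraction on nat truncates. *)
definition bisection :: "'a set \<Rightarrow> 'a set \<Rightarrow> 'a set \<Rightarrow> bool" where
  "bisection V V1 V2 \<longleftrightarrow>
     V1 \<union> V2 = V \<and> V1 \<inter> V2 = {} \<and> \<bar>int (card V1) - int (card V2)\<bar> \<le> 1"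

end

(*
  Relax a partition to a vector x of numbers in [0,1], x v being the probability that v lies in V1.
  The expected number F of uncut edges is a quadratic function of x that is concave in each
  direction raising one coordinate and lowering another, so x can be rounded to a 0/1 vector
  without increasing F, two coordinates at a time.  Moreover e(V1) - e(V2) is the linear function
  (sum of d(v) x(v)) - m.

  We may assume eps < 1.  If all degrees are at most 4 eps m, start at x = 1/2 and round pairs of
  vertices of consecutive degrees to (0,1) or (1,0): this gives a bisection, F <= m/2, and the
  difference e(V1) - e(V2) is at most half the maximum degree.  Hypothesis (i) always leads to this
  case.

  Otherwise (ii) forces m < eps n / 8, so more than half of the vertices are isolated and any
  partition of the others extends to a bisection.  Start with x = 1 on the boundedly many vertices
  of degree above eps m, and x = p elsewhere, where p equalizes the expectations of e(V1) and e(V2)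
  up to the O(1) edges between large vertices, and round along directions fixing sum d(v) x(v).
*)
theory Submission
  imports Defs
begin

section \<open>Edge weights of real vectors on the vertices\<close>

text \<open>For \<open>x\<close> with values in [0,1] this is the expected number of edges inside a
  random set that contains each vertex \<open>v\<close> independently with probability
  \<open>x v\<close>. No range is imposed, so that the same formula also applies to directions of
  movement.\<close>

definition edge_weight :: "'a set set \<Rightarrow> ('a \<Rightarrow> real) \<Rightarrow> real" where
  "edge_weight E x = (\<Sum>e\<in>E. \<Prod>v\<in>e. x v)"

definition uncut_weight :: "'a set set \<Rightarrow> ('a \<Rightarrow> real) \<Rightarrow> real" where
  "uncut_weight E x = edge_weight E x + edge_weight E (\<lambda>v. 1 - x v)"

lemma simple_graph_finite_edges: "simple_graph V E \<Longrightarrow> finite E"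
  unfolding simple_graph_def by (meson PowI finite_Pow_iff finite_subset subsetI)

lemma edge_weight_indicator:
  assumes "simple_graph V E" and "\<And>v. v \<in> V \<Longrightarrow> x v = 0 \<or> x v = 1"
  shows "edge_weight E x = card (spanned_edges E {v \<in> V. x v = 1})"
proof -
  have fE: "finite E" using assms(1) by (rule simple_graph_finite_edges)
  have "(\<Prod>v\<in>e. x v) = (if e \<subseteq> {v \<in> V. x v = 1} then 1 else 0)" if "e \<in> E" for e
  proof -
    have e: "e \<subseteq> V" "finite e"
      using assms(1) that finite_subset unfolding simple_graph_def by blast+
    show ?thesis
    proof (cases "e \<subseteq> {v \<in> V. x v = 1}")
      case True
      then have "(\<Prod>v\<in>e. x v) = 1" by (intro prod.neutral) auto
      then show ?thesis using True by simp
    next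
      case False
      then obtain v where "v \<in> e" "x v = 0" using e(1) assms(2) by blast
      then have "(\<Prod>v\<in>e. x v) = 0" using e(2) by auto
      then show ?thesis using False by simp
    qed
  qed
  then have "edge_weight E x = (\<Sum>e\<in>E. if e \<subseteq> {v \<in> V. x v = 1} then 1 else 0)"
    unfolding edge_weight_def by (intro sum.cong) auto
  also have "\<dots> = real (card (spanned_edges E {v \<in> V. x v = 1}))"
    unfolding spanned_edges_def using fE by (simp add: sum.If_cases Int_def)
  finally show ?thesis .
qed

lemma sum_over_edges:
  fixes f :: "'a \<Rightarrow> real"
  assumes "simple_graph V E"
  shows "(\<Sum>e\<in>E. \<Sum>v\<in>e. f v) = (\<Sum>v\<in>V. real (vertex_degree E v) * f v)"
proof -
  have fE: "finite E" using assms by (rule simple_graph_finite_edges)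
  have fV: "finite V" using assms unfolding simple_graph_def by blast
  have "(\<Sum>e\<in>E. \<Sum>v\<in>e. f v) = (\<Sum>e\<in>E. \<Sum>v\<in>{v \<in> V. v \<in> e}. f v)"
  proof (intro sum.cong refl)
    fix e assume "e \<in> E"
    then show "e = {v \<in> V. v \<in> e}" using assms unfolding simple_graph_def by blast
  qed
  also have "\<dots> = (\<Sum>v\<in>V. \<Sum>e\<in>{e \<in> E. v \<in> e}. f v)"
    using fE fV by (rule sum.swap_restrict)
  finally show ?thesis by (simp add: vertex_degree_def)
qed

lemma sum_vertex_degree:
  assumes "simple_graph V E"
  shows "(\<Sum>v\<in>V. vertex_degree E v) = 2 * card E"
proof -
  have "(\<Sum>v\<in>V. real (vertex_degree E v)) = (\<Sum>e\<in>E. real (card e))"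
    using sum_over_edges[OF assms, of "\<lambda>_. 1"] by simp
  also have "\<dots> = (\<Sum>e\<in>E. 2)"
    using assms unfolding simple_graph_def by (intro sum.cong) auto
  finally have "real (\<Sum>v\<in>V. vertex_degree E v) = real (2 * card E)" by simp
  then show ?thesis using of_nat_eq_iff by blast
qed

text \<open>On an edge {a, b} the quadratic terms of \<open>x a * x b\<close> and
  \<open>(1 - x a) * (1 - x b)\<close> cancel, leaving \<open>x a + x b - 1\<close>; summed over the
  edges, each vertex occurs as often as its degree. Controlling one linear sum therefore controls
  the difference between the two sides.\<close>

lemma edge_weight_difference:
  assumes "simple_graph V E"
  shows "edge_weight E x - edge_weight E (\<lambda>v. 1 - x v)
    = (\<Sum>v\<in>V. real (vertex_degree E v) * x v) - card E"
proof -
  have "(\<Prod>v\<in>e. x v) - (\<Prod>v\<in>e. 1 - x v) = (\<Sum>v\<in>e. x v) - 1" if "e \<in> E" for e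
  proof -
    obtain a b where "e = {a, b}" "a \<noteq> b"
      using assms \<open>e \<in> E\<close> unfolding simple_graph_def by (meson card_2_iff)
    then show ?thesis by (simp add: algebra_simps)
  qed
  then have "edge_weight E x - edge_weight E (\<lambda>v. 1 - x v) = (\<Sum>e\<in>E. (\<Sum>v\<in>e. x v) - 1)"
    unfolding edge_weight_def by (simp flip: sum_subtractf)
  then show ?thesis using sum_over_edges[OF assms, of x] by (simp add: sum_subtractf)
qed

section \<open>Rounding without increasing the uncut weight\<close>

text \<open>Every edge contributes a quadratic polynomial in \<open>t\<close>. Only the sign of the
  leading coefficient will matter, so the linear one stays anonymous.\<close>

lemma edge_weight_line:
  assumes "\<forall>e\<in>E. card e = 2"
  shows "\<exists>b. \<forall>t. edge_weight E (\<lambda>v. x v + t * y v)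
    = edge_weight E x + b * t + edge_weight E y * t\<^sup>2"
proof -
  have "\<exists>b. \<forall>t. (\<Prod>v\<in>e. x v + t * y v) = (\<Prod>v\<in>e. x v) + b * t + (\<Prod>v\<in>e. y v) * t\<^sup>2"
    if "e \<in> E" for e
  proof -
    obtain u w where "e = {u, w}" "u \<noteq> w" using bspec[OF assms \<open>e \<in> E\<close>] by (meson card_2_iff)
    then show ?thesis
      by (intro exI[of _ "x u * y w + x w * y u"]) (simp add: algebra_simps power2_eq_square)
  qed
  then obtain b where "(\<Prod>v\<in>e. x v + t * y v) = (\<Prod>v\<in>e. x v) + b e * t + (\<Prod>v\<in>e. y v) * t\<^sup>2"
    if "e \<in> E" for e t by metis
  then have "edge_weight E (\<lambda>v. x v + t * y v)
      = edge_weight E x + (\<Sum>e\<in>E. b e) * t + edge_weight E y * t\<^sup>2" for t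
    unfolding edge_weight_def by (simp add: sum.distrib sum_distrib_right)
  then show ?thesis by blast
qed

text \<open>Along \<open>y\<close> the uncut weight is quadratic in \<open>t\<close> with
  nonpositive leading coefficient, so it does not increase in the direction in which its linear term
  is nonpositive, however far one goes. The two candidates for \<open>t\<close> cover both
  directions.\<close>

lemma uncut_weight_step:
  assumes E: "\<forall>e\<in>E. card e = 2" and y: "\<forall>e\<in>E. (\<Prod>v\<in>e. y v) \<le> 0"
    and "0 \<le> a" "0 \<le> b"
  shows "\<exists>t\<in>{a, -b}. uncut_weight E (\<lambda>v. x v + t * y v) \<le> uncut_weight E x"
proof -
  obtain c where c: "\<And>t. edge_weight E (\<lambda>v. x v + t * y v)
      = edge_weight E x + c * t + edge_weight E y * t\<^sup>2"
    using edge_weight_line[OF E] by blast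
  obtain d where d: "\<And>t. edge_weight E (\<lambda>v. (1 - x v) + t * (- y v))
      = edge_weight E (\<lambda>v. 1 - x v) + d * t + edge_weight E (\<lambda>v. - y v) * t\<^sup>2"
    using edge_weight_line[OF E, of "\<lambda>v. 1 - x v" "\<lambda>v. - y v"] by blast
  \<comment> \<open>The complementary vector moves along \<open>- y\<close>; as edges have two ends
    the signs cancel, and both summands of \<open>uncut_weight\<close> get the same leading
    coefficient.\<close>
  have yneg: "edge_weight E (\<lambda>v. - y v) = edge_weight E y"
    unfolding edge_weight_def
  proof (intro sum.cong refl)
    fix e assume "e \<in> E"
    then obtain p q where "e = {p, q}" "p \<noteq> q" using E by (meson card_2_iff)
    then show "(\<Prod>v\<in>e. - y v) = (\<Prod>v\<in>e. y v)" by simp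
  qed
  have eq: "uncut_weight E (\<lambda>v. x v + t * y v)
      = uncut_weight E x + (c + d) * t + 2 * edge_weight E y * t\<^sup>2" for t
    using c[of t] d[of t] yneg unfolding uncut_weight_def by (simp add: algebra_simps)
  have "edge_weight E y \<le> 0"
    unfolding edge_weight_def using y by (simp add: sum_nonpos)
  then have "2 * edge_weight E y * t\<^sup>2 \<le> 0" for t :: real
    by (simp add: mult_nonpos_nonneg)
  then have le: "uncut_weight E (\<lambda>v. x v + t * y v) \<le> uncut_weight E x" if "(c + d) * t \<le> 0" for t
    using eq[of t] that by (smt (verit))
  show ?thesis
  proof (cases "c + d \<le> 0")
    case True
    then show ?thesis using le[of a] \<open>0 \<le> a\<close> by (simp add: mult_nonpos_nonneg)
  next
    case False
    then show ?thesis using le[of "-b"] \<open>0 \<le> b\<close> by simp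
  qed
qed

text \<open>The direction is supported on \<open>u\<close> and \<open>w\<close>, so only the edge
  {u, w} can have a nonzero product, namely \<open>- (p * q)\<close>. The two speeds are free so
  that a weighted sum of the coordinates can be kept fixed.\<close>

lemma uncut_weight_step_pair:
  assumes E: "\<forall>e\<in>E. card e = 2" and "u \<noteq> w" "0 \<le> p" "0 \<le> q" "0 \<le> a" "0 \<le> b"
  shows "\<exists>t\<in>{a, -b}. uncut_weight E (x(u := x u + t * p, w := x w - t * q)) \<le> uncut_weight E x"
proof -
  define y where "y = (\<lambda>v. if v = u then p else if v = w then - q else 0)"
  have y: "\<forall>e\<in>E. (\<Prod>v\<in>e. y v) \<le> 0"
  proof
    fix e assume "e \<in> E"
    obtain c d where "e = {c, d}" "c \<noteq> d" using bspec[OF E \<open>e \<in> E\<close>] by (meson card_2_iff)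
    then show "(\<Prod>v\<in>e. y v) \<le> 0" using \<open>u \<noteq> w\<close> \<open>0 \<le> p\<close> \<open>0 \<le> q\<close> by (auto simp: y_def)
  qed
  from uncut_weight_step[OF E y \<open>0 \<le> a\<close> \<open>0 \<le> b\<close>, of x]
  have "\<exists>t\<in>{a, -b}. uncut_weight E (\<lambda>v. x v + t * y v) \<le> uncut_weight E x" .
  moreover have "(\<lambda>v. x v + t * y v) = x(u := x u + t * p, w := x w - t * q)" for t
    using \<open>u \<noteq> w\<close> by (auto simp: y_def)
  ultimately show ?thesis by simp
qed

text \<open>The uncut weight is affine in each single coordinate, since no edge contains a vertex
  twice.\<close>

lemma uncut_weight_round_vertex:
  assumes E: "\<forall>e\<in>E. card e = 2" and "0 \<le> x u" "x u \<le> 1"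
  shows "\<exists>c\<in>{0, 1}. uncut_weight E (x(u := c)) \<le> uncut_weight E x"
proof -
  define y where "y = (\<lambda>v. if v = u then 1 else 0 :: real)"
  have y: "\<forall>e\<in>E. (\<Prod>v\<in>e. y v) \<le> 0"
  proof
    fix e assume "e \<in> E"
    obtain c d where "e = {c, d}" "c \<noteq> d" using bspec[OF E \<open>e \<in> E\<close>] by (meson card_2_iff)
    then show "(\<Prod>v\<in>e. y v) \<le> 0" by (auto simp: y_def)
  qed
  from uncut_weight_step[OF E y, of "1 - x u" "x u" x] assms(2,3)
  have "\<exists>t\<in>{1 - x u, - x u}. uncut_weight E (\<lambda>v. x v + t * y v) \<le> uncut_weight E x" by simp
  moreover have "(\<lambda>v. x v + t * y v) = x(u := x u + t)" for t
    by (auto simp: y_def)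
  ultimately show ?thesis by auto
qed

lemma obtain_max:
  fixes f :: "'a \<Rightarrow> 'b :: linorder"
  assumes "finite S" "S \<noteq> {}"
  shows "\<exists>u\<in>S. \<forall>v\<in>S. f v \<le> f u"
proof -
  have "Max (f ` S) \<in> f ` S" using assms by (intro Max_in) auto
  moreover have "f v \<le> Max (f ` S)" if "v \<in> S" for v using assms that by (intro Max_ge) auto
  ultimately show ?thesis by (smt (verit) imageE)
qed

text \<open>The two vertices of largest \<open>d\<close> are rounded in opposite directions, and so
  on with the rest. The errors telescope: the first pair costs \<open>(d u - d w) / 2\<close>, the
  remaining ones at most \<open>d w / 2\<close>, together \<open>d u / 2\<close>. A last unpaired
  vertex, if any, accounts for the imbalance 1/2.\<close>

lemma balanced_rounding:
  fixes d :: "'a \<Rightarrow> real"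
  assumes E: "\<forall>e\<in>E. card e = 2" and "finite S"
    and "\<And>v. v \<in> S \<Longrightarrow> x v = 1/2" and "\<And>v. v \<in> S \<Longrightarrow> 0 \<le> d v \<and> d v \<le> M" and "0 \<le> M"
  shows "\<exists>z. (\<forall>v. v \<notin> S \<longrightarrow> z v = x v) \<and> (\<forall>v\<in>S. z v = 0 \<or> z v = 1)
    \<and> uncut_weight E z \<le> uncut_weight E x
    \<and> \<bar>\<Sum>v\<in>S. z v - 1/2\<bar> \<le> 1/2 \<and> \<bar>\<Sum>v\<in>S. d v * (z v - 1/2)\<bar> \<le> M/2"
  using assms(2-)
proof (induction "card S" arbitrary: S x M rule: less_induct)
  case less
  show ?case
  proof (cases "S = {}")
    case True
    then show ?thesis using less.prems by auto
  next
    case False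
    obtain u where u: "u \<in> S" "\<And>v. v \<in> S \<Longrightarrow> d v \<le> d u"
      using obtain_max[OF \<open>finite S\<close> False, of d] by blast
    define T where "T = S - {u}"
    have T: "S = insert u T" "u \<notin> T" "finite T" using u(1) less.prems(1) unfolding T_def by auto
    show ?thesis
    proof (cases "T = {}")
      case True
      obtain c where "c \<in> {0, 1}" "uncut_weight E (x(u := c)) \<le> uncut_weight E x"
        using uncut_weight_round_vertex[OF E, of x u] less.prems(2)[OF u(1)] by auto
      then show ?thesis
        using True T(1) less.prems(3)[OF u(1)] by (intro exI[of _ "x(u := c)"]) auto
    next
      case False
      obtain w where w: "w \<in> T" "\<And>v. v \<in> T \<Longrightarrow> d v \<le> d w"
        using obtain_max[OF \<open>finite T\<close> False, of d] by blast
      define R where "R = T - {w}"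
      have R: "T = insert w R" "w \<notin> R" "finite R" using w(1) T(3) unfolding R_def by auto
      have uw: "u \<noteq> w" "u \<notin> R" using T(2) w(1) R(1) by auto
      have x: "x u = 1/2" "x w = 1/2" using less.prems(2) T(1) R(1) by auto
      \<comment> \<open>From 1/2, a step of length 1/2 lands the pair on (1,0) or (0,1), which
        leaves the unweighted sum unchanged.\<close>
      have "\<exists>t\<in>{1/2, -(1/2)}. uncut_weight E (x(u := x u + t, w := x w - t)) \<le> uncut_weight E x"
        using uncut_weight_step_pair[OF E uw(1), of 1 1 "1/2" "1/2" x] by simp
      then obtain t where t: "t \<in> {1/2, -(1/2)}"
        "uncut_weight E (x(u := x u + t, w := x w - t)) \<le> uncut_weight E x" ..
      define x' where "x' = x(u := x u + t, w := x w - t)"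
      have less_card: "card R < card S" using T R uw by simp
      have x'R: "x' v = 1/2" if "v \<in> R" for v
        using that less.prems(2)[of v] T(1) R uw unfolding x'_def by auto
      have dR: "0 \<le> d v \<and> d v \<le> d w" if "v \<in> R" for v
        using that less.prems(3)[of v] w(2)[of v] T(1) R(1) by auto
      have dw: "0 \<le> d w" using less.prems(3)[of w] T(1) R(1) by simp
      \<comment> \<open>The induction hypothesis is used with \<open>d w\<close> in place of
        \<open>M\<close>; this is what makes the errors telescope.\<close>
      have "\<exists>z. (\<forall>v. v \<notin> R \<longrightarrow> z v = x' v) \<and> (\<forall>v\<in>R. z v = 0 \<or> z v = 1)
          \<and> uncut_weight E z \<le> uncut_weight E x'
          \<and> \<bar>\<Sum>v\<in>R. z v - 1/2\<bar> \<le> 1/2 \<and> \<bar>\<Sum>v\<in>R. d v * (z v - 1/2)\<bar> \<le> d w / 2"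
        using less_card R(3) x'R dR dw by (rule less.hyps)
      then obtain z where z: "\<forall>v. v \<notin> R \<longrightarrow> z v = x' v" "\<forall>v\<in>R. z v = 0 \<or> z v = 1"
        "uncut_weight E z \<le> uncut_weight E x'" "\<bar>\<Sum>v\<in>R. z v - 1/2\<bar> \<le> 1/2"
        "\<bar>\<Sum>v\<in>R. d v * (z v - 1/2)\<bar> \<le> d w / 2"
        by blast
      have zuw: "z u = 1/2 + t" "z w = 1/2 - t"
        using z(1) uw R(2) x unfolding x'_def by auto
      have total: "(\<Sum>v\<in>S. d v * (z v - 1/2)) = t * (d u - d w) + (\<Sum>v\<in>R. d v * (z v - 1/2))"
      proof -
        have "(\<Sum>v\<in>S. d v * (z v - 1/2))
            = d u * (z u - 1/2) + (d w * (z w - 1/2) + (\<Sum>v\<in>R. d v * (z v - 1/2)))"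
          using T R uw by simp
        then show ?thesis unfolding zuw by (simp add: algebra_simps)
      qed
      have swap: "\<bar>t * (d u - d w)\<bar> \<le> (d u - d w) / 2"
      proof -
        have "\<bar>t\<bar> = 1/2" using t(1) by auto
        moreover have "d w \<le> d u" using u(2)[of w] T(1) w(1) by simp
        ultimately have "\<bar>t * (d u - d w)\<bar> = 1/2 * (d u - d w)" by (simp only: abs_mult)
        then show ?thesis by simp
      qed
      have "d u \<le> M" using less.prems(3) u(1) by blast
      then have "\<bar>\<Sum>v\<in>S. d v * (z v - 1/2)\<bar> \<le> M/2"
        unfolding total using order_trans[OF abs_triangle_ineq add_mono[OF swap z(5)]]
        by (simp flip: add_divide_distrib)
      moreover have "(\<Sum>v\<in>S. z v - 1/2) = (\<Sum>v\<in>R. z v - 1/2)"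
        using T R uw zuw by simp
      moreover have "\<forall>v. v \<notin> S \<longrightarrow> z v = x v" using z(1) T(1) R(1) unfolding x'_def by auto
      moreover have "\<forall>v\<in>S. z v = 0 \<or> z v = 1" using z(2) zuw t(1) T(1) R(1) by auto
      moreover have "uncut_weight E z \<le> uncut_weight E x" using z(3) t(2) unfolding x'_def by simp
      ultimately show ?thesis using z(4) by (intro exI[of _ z]) simp
    qed
  qed
qed

text \<open>Each step makes one more coordinate integral while keeping the sum of
  \<open>d v * x v\<close> fixed. Only when a single vertex is left can that sum change, by at most
  its \<open>d\<close>.\<close>

lemma weighted_rounding:
  fixes d :: "'a \<Rightarrow> real"
  assumes E: "\<forall>e\<in>E. card e = 2" and "finite S"
    and "\<And>v. v \<in> S \<Longrightarrow> 0 \<le> x v \<and> x v \<le> 1" and "\<And>v. v \<in> S \<Longrightarrow> 0 \<le> d v \<and> d v \<le> M" and "0 \<le> M"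
  shows "\<exists>z. (\<forall>v. v \<notin> S \<longrightarrow> z v = x v) \<and> (\<forall>v\<in>S. z v = 0 \<or> z v = 1)
    \<and> uncut_weight E z \<le> uncut_weight E x \<and> \<bar>\<Sum>v\<in>S. d v * (z v - x v)\<bar> \<le> M"
  using assms(2-)
proof (induction "card S" arbitrary: S x rule: less_induct)
  case less
  \<comment> \<open>The inductive step in general form: after any move that preserves the weighted
    sum and makes the coordinate of \<open>u\<close> integral, the induction hypothesis handles
    \<open>S - {u}\<close>.\<close>
  have reduce: ?case
    if u: "u \<in> S" and x': "\<And>v. v \<notin> S \<Longrightarrow> x' v = x v" "\<And>v. v \<in> S \<Longrightarrow> 0 \<le> x' v \<and> x' v \<le> 1"
      "x' u = 0 \<or> x' u = 1" "uncut_weight E x' \<le> uncut_weight E x"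
      "(\<Sum>v\<in>S. d v * (x' v - x v)) = 0" for u x'
  proof -
    have "card (S - {u}) < card S" using u less.prems(1) by (meson card_Diff1_less)
    then have "\<exists>z. (\<forall>v. v \<notin> S - {u} \<longrightarrow> z v = x' v) \<and> (\<forall>v\<in>S - {u}. z v = 0 \<or> z v = 1)
        \<and> uncut_weight E z \<le> uncut_weight E x' \<and> \<bar>\<Sum>v\<in>S - {u}. d v * (z v - x' v)\<bar> \<le> M"
      by (rule less.hyps) (use less.prems x'(2) in auto)
    then obtain z where z: "\<forall>v. v \<notin> S - {u} \<longrightarrow> z v = x' v" "\<forall>v\<in>S - {u}. z v = 0 \<or> z v = 1"
      "uncut_weight E z \<le> uncut_weight E x'" "\<bar>\<Sum>v\<in>S - {u}. d v * (z v - x' v)\<bar> \<le> M"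
      by blast
    have zu: "z u = x' u" using z(1) by simp
    have "(\<Sum>v\<in>S. d v * (z v - x v)) = (\<Sum>v\<in>S. d v * (z v - x' v)) + (\<Sum>v\<in>S. d v * (x' v - x v))"
      by (simp add: algebra_simps flip: sum.distrib)
    also have "(\<Sum>v\<in>S. d v * (z v - x' v)) = (\<Sum>v\<in>S - {u}. d v * (z v - x' v))"
      using zu u less.prems(1) by (simp add: sum.remove)
    finally have "\<bar>\<Sum>v\<in>S. d v * (z v - x v)\<bar> \<le> M" using z(4) x'(5) by simp
    moreover have "\<forall>v\<in>S. z v = 0 \<or> z v = 1" using z(2) zu x'(3) by (metis DiffI singletonD)
    moreover have "\<forall>v. v \<notin> S \<longrightarrow> z v = x v" using z(1) x'(1) by simp
    ultimately show ?thesis using z(3) x'(4) by (intro exI[of _ z]) simp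
  qed
  have round: "\<exists>c\<in>{0, 1}. uncut_weight E (x(u := c)) \<le> uncut_weight E x" if "u \<in> S" for u
    using uncut_weight_round_vertex[OF E, of x u] less.prems(2)[OF that] by auto
  show ?case
  proof (cases "S = {}")
    case True
    then show ?thesis using less.prems by auto
  next
    case False
    then obtain u where u: "u \<in> S" by blast
    have pos: "d v = 0 \<or> d v > 0" if "v \<in> S" for v using less.prems(3)[OF that] by auto
    \<comment> \<open>A vertex with \<open>d\<close> zero can be rounded alone without affecting the
      weighted sum; two vertices with positive \<open>d\<close> are moved together.\<close>
    consider "d u = 0" | "S = {u}" | w where "w \<in> S" "w \<noteq> u" "d w = 0"
      | w where "w \<in> S" "w \<noteq> u" "d u > 0" "d w > 0"
      using u pos by blast
    then show ?thesis
    proof cases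
      case 1
      obtain c where "c \<in> {0, 1}" "uncut_weight E (x(u := c)) \<le> uncut_weight E x"
        using round[OF u] by blast
      then show ?thesis
        using u less.prems(2) 1 by (intro reduce[of u "x(u := c)"]) (auto intro!: sum.neutral)
    next
      case 2
      obtain c where c: "c \<in> {0, 1}" "uncut_weight E (x(u := c)) \<le> uncut_weight E x"
        using round[OF u] by blast
      have "\<bar>c - x u\<bar> \<le> 1" using c(1) less.prems(2)[OF u] by auto
      then have "d u * \<bar>c - x u\<bar> \<le> M * 1"
        using less.prems(3)[OF u] by (intro mult_mono) auto
      then have "\<bar>d u * (c - x u)\<bar> \<le> M" using less.prems(3)[OF u] by (simp add: abs_mult)
      then show ?thesis using 2 c by (intro exI[of _ "x(u := c)"]) auto
    next
      case (3 w)
      obtain c where "c \<in> {0, 1}" "uncut_weight E (x(w := c)) \<le> uncut_weight E x"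
        using round[OF 3(1)] by blast
      then show ?thesis
        using 3 less.prems(2) by (intro reduce[of w "x(w := c)"]) (auto intro!: sum.neutral)
    next
      case (4 w)
      have xu: "0 \<le> x u" "x u \<le> 1" and xw: "0 \<le> x w" "x w \<le> 1"
        using less.prems(2) u 4(1) by auto
      \<comment> \<open>The speeds \<open>d w\<close> and \<open>d u\<close> keep
        \<open>d u * x u + d w * x w\<close> fixed. \<open>a\<close> is the time at which
        \<open>u\<close> reaches 1 or \<open>w\<close> reaches 0, whichever is first;
        \<open>b\<close> is the analogue in the opposite direction. Either way one of the two
        coordinates becomes integral.\<close>
      define a where "a = min ((1 - x u) / d w) (x w / d u)"
      define b where "b = min (x u / d w) ((1 - x w) / d u)"
      have ab: "0 \<le> a" "0 \<le> b" unfolding a_def b_def using xu xw 4 by auto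
      have "\<exists>t\<in>{a, -b}. uncut_weight E (x(u := x u + t * d w, w := x w - t * d u)) \<le> uncut_weight E x"
        using uncut_weight_step_pair[OF E, of u w "d w" "d u" a b x] 4 ab by simp
      then obtain t where t: "t \<in> {a, -b}"
        "uncut_weight E (x(u := x u + t * d w, w := x w - t * d u)) \<le> uncut_weight E x" ..
      define x' where "x' = x(u := x u + t * d w, w := x w - t * d u)"
      have x'u: "x' u = x u + t * d w" and x'w: "x' w = x w - t * d u"
        using 4(2) unfolding x'_def by auto
      have x'o: "x' v = x v" if "v \<noteq> u" "v \<noteq> w" for v using that unfolding x'_def by simp
      have bounds: "0 \<le> x' u \<and> x' u \<le> 1 \<and> 0 \<le> x' w \<and> x' w \<le> 1 \<and>
          (x' u = 0 \<or> x' u = 1 \<or> x' w = 0 \<or> x' w = 1)"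
      proof (cases "t = a")
        case True
        have "a * d w \<le> 1 - x u" "a * d u \<le> x w"
          using 4 unfolding a_def by (simp_all add: min_le_iff_disj flip: pos_le_divide_eq)
        moreover have "a * d w = 1 - x u \<or> a * d u = x w"
          using 4 unfolding a_def by (auto simp: min_def)
        moreover have "0 \<le> a * d w" "0 \<le> a * d u" using ab 4 by auto
        ultimately show ?thesis using xu xw True unfolding x'u x'w by auto
      next
        case False
        then have tb: "t = -b" using t(1) by simp
        have "b * d w \<le> x u" "b * d u \<le> 1 - x w"
          using 4 unfolding b_def by (simp_all add: min_le_iff_disj flip: pos_le_divide_eq)
        moreover have "b * d w = x u \<or> b * d u = 1 - x w"
          using 4 unfolding b_def by (auto simp: min_def)
        moreover have "0 \<le> b * d w" "0 \<le> b * d u" using ab 4 by auto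
        ultimately show ?thesis using xu xw unfolding x'u x'w tb by auto
      qed
      have range: "0 \<le> x' v \<and> x' v \<le> 1" if "v \<in> S" for v
        using bounds x'o[of v] less.prems(2)[OF that] by metis
      have "(\<Sum>v\<in>S. d v * (x' v - x v)) = (\<Sum>v\<in>{u, w}. d v * (x' v - x v))"
        using u 4(1) less.prems(1) x'o by (intro sum.mono_neutral_right) auto
      also have "\<dots> = 0" using 4(2) by (simp add: x'u x'w)
      finally have sum0: "(\<Sum>v\<in>S. d v * (x' v - x v)) = 0" .
      have out: "x' v = x v" if "v \<notin> S" for v using that u 4(1) x'o by metis
      show ?thesis
      proof (cases "x' u = 0 \<or> x' u = 1")
        case True
        show ?thesis by (rule reduce[OF u out range True t(2)[folded x'_def] sum0])
      next
        case False
        then have w: "x' w = 0 \<or> x' w = 1" using bounds by blast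
        show ?thesis by (rule reduce[OF 4(1) out range w t(2)[folded x'_def] sum0])
      qed
    qed
  qed
qed

section \<open>Bisections when all degrees are small\<close>

text \<open>Rounding the constant vector 1/2 gives two sides whose edge counts have sum at most m/2,
  for m the number of edges, and differ by at most \<open>M / 2\<close>.\<close>

lemma bisection_of_max_degree:
  assumes G: "simple_graph V E" and deg: "\<And>v. v \<in> V \<Longrightarrow> real (vertex_degree E v) \<le> M" and "0 \<le> M"
  shows "\<exists>V1 V2. bisection V V1 V2 \<and>
    real (card (spanned_edges E V1)) \<le> card E / 4 + M / 4 \<and>
    real (card (spanned_edges E V2)) \<le> card E / 4 + M / 4"
proof -
  let ?d = "\<lambda>v. real (vertex_degree E v)"
  have fV: "finite V" and E2: "\<forall>e\<in>E. card e = 2"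
    using G unfolding simple_graph_def by auto
  obtain z where z: "\<And>v. v \<in> V \<Longrightarrow> z v = 0 \<or> z v = 1"
    "uncut_weight E z \<le> uncut_weight E (\<lambda>_. 1/2)" "\<bar>\<Sum>v\<in>V. z v - 1/2\<bar> \<le> 1/2"
    "\<bar>\<Sum>v\<in>V. ?d v * (z v - 1/2)\<bar> \<le> M/2"
    using balanced_rounding[OF E2 fV, of "\<lambda>_. 1/2" ?d M] deg \<open>0 \<le> M\<close> by auto
  define V1 where "V1 = {v \<in> V. z v = 1}"
  define V2 where "V2 = {v \<in> V. z v = 0}"
  have V2': "V2 = {v \<in> V. 1 - z v = 1}" unfolding V2_def by simp
  have e1: "edge_weight E z = card (spanned_edges E V1)"
    unfolding V1_def by (rule edge_weight_indicator[OF G z(1)])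
  have e2: "edge_weight E (\<lambda>v. 1 - z v) = card (spanned_edges E V2)"
    unfolding V2' using z(1) by (intro edge_weight_indicator[OF G]) auto
  have parts: "V1 \<union> V2 = V" "V1 \<inter> V2 = {}" using z(1) unfolding V1_def V2_def by auto
  have fin: "finite V1" "finite V2" using fV unfolding V1_def V2_def by auto
  have "(\<Sum>v\<in>V. z v - 1/2) = (\<Sum>v\<in>V1. z v - 1/2) + (\<Sum>v\<in>V2. z v - 1/2)"
    using sum.union_disjoint[OF fin parts(2), of "\<lambda>v. z v - 1/2"] parts(1) by simp
  also have "\<dots> = (real (card V1) - real (card V2)) / 2"
    unfolding V1_def V2_def by (simp add: diff_divide_distrib)
  finally have "\<bar>real (card V1) - real (card V2)\<bar> \<le> 1" using z(3) by simp
  then have "bisection V V1 V2" using parts unfolding bisection_def by linarith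
  moreover have "uncut_weight E (\<lambda>_. 1/2) = card E / 2"
    unfolding uncut_weight_def edge_weight_def using E2 by (simp add: power2_eq_square)
  moreover have "(\<Sum>v\<in>V. ?d v * (z v - 1/2)) = (\<Sum>v\<in>V. ?d v * z v) - real (\<Sum>v\<in>V. vertex_degree E v) / 2"
    by (simp add: right_diff_distrib sum_subtractf sum_divide_distrib)
  ultimately have "real (card (spanned_edges E V1)) \<le> card E / 4 + M / 4"
    "real (card (spanned_edges E V2)) \<le> card E / 4 + M / 4"
    using z(2,4) edge_weight_difference[OF G, of z]
    unfolding uncut_weight_def e1 e2 sum_vertex_degree[OF G] by linarith+
  then show ?thesis using \<open>bisection V V1 V2\<close> by blast
qed

section \<open>Partitions with the vertices of large degree on one side\<close>

text \<open>All of \<open>H\<close> goes to \<open>V1\<close>, and only the vertices outside are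
  rounded, where \<open>M\<close> bounds the degrees. Up to the edges inside \<open>H\<close>, the
  starting vector gives both sides equal weight, at most a quarter of the other edges; the rounding
  moves the difference by at most \<open>M\<close>.\<close>

lemma partition_with_bounded_degree_outside:
  assumes G: "simple_graph V E" and "H \<subseteq> V"
    and deg: "\<And>v. v \<in> V - H \<Longrightarrow> real (vertex_degree E v) \<le> M" and "0 \<le> M"
  shows "\<exists>V1 V2. V1 \<union> V2 = V \<and> V1 \<inter> V2 = {} \<and>
    real (card (spanned_edges E V1)) \<le> card E / 4 + card (spanned_edges E H) + M / 2 \<and>
    real (card (spanned_edges E V2)) \<le> card E / 4 + card (spanned_edges E H) + M / 2"
proof -
  let ?d = "\<lambda>v. real (vertex_degree E v)"
  have fV: "finite V" and E2: "\<forall>e\<in>E. card e = 2"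
    using G unfolding simple_graph_def by auto
  have fE: "finite E" using G by (rule simple_graph_finite_edges)
  define EH where "EH = spanned_edges E H"
  define ER where "ER = {e \<in> E. e \<inter> H = {}}"
  \<comment> \<open>These are the edges with exactly one end in \<open>H\<close>.\<close>
  define EC where "EC = E - EH - ER"
  define k where "k = real (card EH)"
  define r where "r = real (card ER)"
  define h where "h = real (card EC)"
  have fin: "finite EH" "finite ER" "finite EC"
    using fE unfolding EH_def ER_def EC_def spanned_edges_def by auto
  have "EH \<inter> ER = {}"
  proof -
    have "e \<noteq> {}" if "e \<in> E" for e using bspec[OF E2 that] by auto
    then show ?thesis unfolding EH_def ER_def spanned_edges_def by blast
  qed
  then have split: "(\<Sum>e\<in>E. f e) = (\<Sum>e\<in>EH. f e) + (\<Sum>e\<in>EC. f e) + (\<Sum>e\<in>ER. f e)"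
    for f :: "'a set \<Rightarrow> real"
  proof -
    have "E = EH \<union> (EC \<union> ER)"
      unfolding EC_def EH_def ER_def spanned_edges_def by blast
    moreover have "EH \<inter> (EC \<union> ER) = {}" "EC \<inter> ER = {}"
      using \<open>EH \<inter> ER = {}\<close> unfolding EC_def by auto
    ultimately show ?thesis
      using fin by (simp add: sum.union_disjoint)
  qed
  have m: "real (card E) = k + h + r"
    using split[of "\<lambda>_. 1"] unfolding k_def h_def r_def by simp
  have nonneg: "0 \<le> k" "0 \<le> h" "0 \<le> r" unfolding k_def h_def r_def by auto
  \<comment> \<open>The solution of \<open>p * h + p\<^sup>2 * r = (1 - p)\<^sup>2 * r\<close>. If
    \<open>h + 2 * r = 0\<close>, division by zero yields \<open>p = 0\<close>, which is harmless
    because then \<open>h = r = 0\<close>.\<close>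
  define p where "p = r / (h + 2 * r)"
  have p: "0 \<le> p" "p \<le> 1" "p * h = (1 - 2 * p) * r"
    and p_le: "(1 - p)\<^sup>2 * r \<le> (h + r) / 4"
  proof -
    show "0 \<le> p" "p \<le> 1" unfolding p_def using nonneg by (auto simp: divide_le_eq)
    show ph: "p * h = (1 - 2 * p) * r"
      unfolding p_def using nonneg by (cases "h + 2 * r = 0") (auto simp: field_simps)
    show "(1 - p)\<^sup>2 * r \<le> (h + r) / 4"
    proof (cases "h + 2 * r = 0")
      case True
      then have "r = 0" using nonneg by linarith
      then show ?thesis using nonneg by simp
    next
      case False
      then have pos: "0 < h + 2 * r" using nonneg by linarith
      have p': "1 - p = (h + r) / (h + 2 * r)" unfolding p_def using pos by (simp add: field_simps)
      \<comment> \<open>After cancelling \<open>h + r\<close> this is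
        \<open>4 * r * (h + r) \<le> (h + 2 * r)\<^sup>2\<close>, where the two sides differ by the
        square of \<open>h\<close>.\<close>
      have le: "4 * ((h + r)\<^sup>2 * r) \<le> (h + r) * (h + 2 * r)\<^sup>2"
      proof -
        have "(h + r) * (h + 2 * r)\<^sup>2 - 4 * ((h + r)\<^sup>2 * r) = (h + r) * h\<^sup>2"
          by (simp add: power2_eq_square algebra_simps)
        moreover have "0 \<le> (h + r) * h\<^sup>2" using nonneg by simp
        ultimately show ?thesis by linarith
      qed
      have "(1 - p)\<^sup>2 * r = (h + r)\<^sup>2 * r / (h + 2 * r)\<^sup>2"
        unfolding p' by (simp add: power_divide)
      also have "\<dots> \<le> (h + r) / 4" using le pos by (simp add: pos_divide_le_eq)
      finally show ?thesis .
    qed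
  qed
  define x where "x = (\<lambda>v. if v \<in> H then 1 else p)"
  have prodsH: "(\<Prod>v\<in>e. x v) = 1 \<and> (\<Prod>v\<in>e. 1 - x v) = 0" if "e \<in> EH" for e
  proof -
    have "e \<subseteq> H" "card e = 2" using that E2 unfolding EH_def spanned_edges_def by auto
    moreover obtain a b where "e = {a, b}" "a \<noteq> b" using calculation(2) by (meson card_2_iff)
    ultimately show ?thesis by (auto simp: x_def)
  qed
  have prodsR: "(\<Prod>v\<in>e. x v) = p\<^sup>2 \<and> (\<Prod>v\<in>e. 1 - x v) = (1 - p)\<^sup>2" if "e \<in> ER" for e
  proof -
    have "e \<inter> H = {}" "card e = 2" using that E2 unfolding ER_def by auto
    moreover obtain a b where "e = {a, b}" "a \<noteq> b" using calculation(2) by (meson card_2_iff)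
    ultimately show ?thesis by (auto simp: x_def power2_eq_square)
  qed
  have prodsC: "(\<Prod>v\<in>e. x v) = p \<and> (\<Prod>v\<in>e. 1 - x v) = 0" if "e \<in> EC" for e
  proof -
    have "e \<inter> H \<noteq> {}" "\<not> e \<subseteq> H" "card e = 2"
      using that E2 unfolding EC_def EH_def ER_def spanned_edges_def by auto
    moreover obtain a b where "e = {a, b}" "a \<noteq> b" using calculation(3) by (meson card_2_iff)
    ultimately show ?thesis by (auto simp: x_def)
  qed
  have w1: "edge_weight E x = k + p * h + p\<^sup>2 * r"
    unfolding edge_weight_def split using prodsH prodsR prodsC
    by (simp add: k_def h_def r_def)
  have w2: "edge_weight E (\<lambda>v. 1 - x v) = (1 - p)\<^sup>2 * r"
    unfolding edge_weight_def split using prodsH prodsR prodsC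
    by (simp add: k_def h_def r_def)
  \<comment> \<open>By the choice of \<open>p\<close>, the difference of the two expectations is
    exactly \<open>k\<close>.\<close>
  have eq: "edge_weight E x = k + (1 - p)\<^sup>2 * r"
    unfolding w1 using p(3) by (simp add: power2_eq_square algebra_simps)
  obtain z where z: "\<And>v. v \<notin> V - H \<Longrightarrow> z v = x v" "\<And>v. v \<in> V - H \<Longrightarrow> z v = 0 \<or> z v = 1"
    "uncut_weight E z \<le> uncut_weight E x" "\<bar>\<Sum>v\<in>V - H. ?d v * (z v - x v)\<bar> \<le> M"
    using weighted_rounding[OF E2, of "V - H" x ?d M] fV deg \<open>0 \<le> M\<close> p(1,2) unfolding x_def by auto
  have z01: "z v = 0 \<or> z v = 1" if "v \<in> V" for v
    using z(1)[of v] z(2)[of v] that unfolding x_def by auto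
  define V1 where "V1 = {v \<in> V. z v = 1}"
  define V2 where "V2 = {v \<in> V. z v = 0}"
  have V2': "V2 = {v \<in> V. 1 - z v = 1}" unfolding V2_def by simp
  have e1: "edge_weight E z = card (spanned_edges E V1)"
    unfolding V1_def by (rule edge_weight_indicator[OF G z01])
  have e2: "edge_weight E (\<lambda>v. 1 - z v) = card (spanned_edges E V2)"
    unfolding V2' using z01 by (intro edge_weight_indicator[OF G]) auto
  have parts: "V1 \<union> V2 = V" "V1 \<inter> V2 = {}" using z01 unfolding V1_def V2_def by auto
  have "(\<Sum>v\<in>V. ?d v * (z v - x v)) = (\<Sum>v\<in>V - H. ?d v * (z v - x v))"
    using fV z(1) by (intro sum.mono_neutral_right) auto
  then have "\<bar>(\<Sum>v\<in>V. ?d v * z v) - (\<Sum>v\<in>V. ?d v * x v)\<bar> \<le> M"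
    using z(4) by (simp add: right_diff_distrib sum_subtractf)
  then have diff: "\<bar>real (card (spanned_edges E V1)) - real (card (spanned_edges E V2)) - k\<bar> \<le> M"
    using edge_weight_difference[OF G, of z] edge_weight_difference[OF G, of x]
    unfolding e1 e2 w2 eq by simp
  have sum: "real (card (spanned_edges E V1)) + real (card (spanned_edges E V2))
      \<le> k + 2 * ((h + r) / 4)"
    using z(3) p_le unfolding uncut_weight_def e1 e2 w2 eq by linarith
  have k: "real (card (spanned_edges E H)) = k" unfolding k_def EH_def ..
  have "real (card (spanned_edges E V1)) \<le> card E / 4 + card (spanned_edges E H) + M / 2"
    using sum abs_le_D1[OF diff] abs_le_D2[OF diff] nonneg unfolding m k by (simp add: field_simps)
  moreover have "real (card (spanned_edges E V2)) \<le> card E / 4 + card (spanned_edges E H) + M / 2"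
    using sum abs_le_D1[OF diff] abs_le_D2[OF diff] nonneg unfolding m k by (simp add: field_simps)
  ultimately show ?thesis using parts by blast
qed

section \<open>Few vertices of large degree, many isolated vertices\<close>

text \<open>Markov's inequality for the degrees, whose sum is twice the number of edges. The bound
  is the same for all graphs.\<close>

lemma card_large_degree:
  assumes G: "simple_graph V E" and "0 < c" "0 < card E"
  shows "card {v \<in> V. c * real (card E) < real (vertex_degree E v)} \<le> 2 / c"
proof -
  let ?H = "{v \<in> V. c * real (card E) < real (vertex_degree E v)}"
  have fV: "finite V" using G unfolding simple_graph_def by auto
  have "real (card ?H) * (c * real (card E)) \<le> (\<Sum>v\<in>?H. real (vertex_degree E v))"
    by (rule sum_bounded_below) auto
  also have "\<dots> \<le> (\<Sum>v\<in>V. real (vertex_degree E v))"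
    using fV by (intro sum_mono2) auto
  also have "\<dots> = real (\<Sum>v\<in>V. vertex_degree E v)" by simp
  also have "\<dots> = 2 * real (card E)" unfolding sum_vertex_degree[OF G] by simp
  finally have "(real (card ?H) * c) * real (card E) \<le> 2 * real (card E)" by (simp add: mult.assoc)
  then have "real (card ?H) * c \<le> 2" using \<open>0 < card E\<close> by simp
  then show ?thesis using \<open>0 < c\<close> by (simp add: pos_le_divide_eq)
qed

lemma vertex_degree_le_card:
  assumes G: "simple_graph V E"
  shows "vertex_degree E v \<le> card V"
proof -
  have fV: "finite V" using G unfolding simple_graph_def by auto
  have "{e \<in> E. v \<in> e} \<subseteq> (\<lambda>u. {v, u}) ` V"
  proof
    fix e assume "e \<in> {e \<in> E. v \<in> e}"
    then have e: "e \<subseteq> V" "card e = 2" "v \<in> e" using G unfolding simple_graph_def by auto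
    then obtain a b where "e = {a, b}" by (meson card_2_iff)
    then show "e \<in> (\<lambda>u. {v, u}) ` V" using e(1,3) by auto
  qed
  then show ?thesis
    unfolding vertex_degree_def using fV by (meson surj_card_le)
qed

text \<open>At most half of the vertices lie on edges. Keeping their partition and redistributing
  the isolated vertices balances the sides without adding edges to either.\<close>

lemma bisection_of_sparse:
  assumes G: "simple_graph V E" and sparse: "4 * card E \<le> card V"
    and parts: "W1 \<union> W2 = V" "W1 \<inter> W2 = {}"
  shows "\<exists>V1 V2. bisection V V1 V2 \<and> card (spanned_edges E V1) \<le> card (spanned_edges E W1) \<and>
    card (spanned_edges E V2) \<le> card (spanned_edges E W2)"
proof -
  have fV: "finite V" and E: "\<forall>e\<in>E. e \<subseteq> V \<and> card e = 2"
    using G unfolding simple_graph_def by auto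
  have fE: "finite E" using G by (rule simple_graph_finite_edges)
  define U where "U = \<Union>E"
  have UV: "U \<subseteq> V" unfolding U_def using E by blast
  have "card U \<le> (\<Sum>e\<in>E. card e)" unfolding U_def by (rule card_Union_le_sum_card)
  also have "\<dots> = 2 * card E" using E by simp
  finally have cU: "card U \<le> 2 * card E" .
  have fU: "finite U" using UV fV finite_subset by blast
  define A where "A = W1 \<inter> U"
  have A: "A \<subseteq> U" "finite A" "card A \<le> card U"
    unfolding A_def using fU by (auto intro: card_mono)
  \<comment> \<open>There are enough isolated vertices to fill \<open>V1\<close> up to half of
    \<open>V\<close>, rounded down. The subtraction does not truncate, as \<open>card A\<close> is
    at most \<open>card V div 2\<close>.\<close>
  have "card V div 2 - card A \<le> card (V - U)"
    using cU sparse card_Diff_subset[OF fU UV] by linarith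
  then obtain I where I: "I \<subseteq> V - U" "card I = card V div 2 - card A"
    by (meson obtain_subset_with_card_n)
  define V1 where "V1 = A \<union> I"
  define V2 where "V2 = V - V1"
  have V1V: "V1 \<subseteq> V" unfolding V1_def using A(1) I(1) UV by blast
  have "card V1 = card A + card I"
    unfolding V1_def using A I(1) fV by (intro card_Un_disjoint) (auto intro: finite_subset)
  then have c1: "card V1 = card V div 2" using I(2) A(3) cU sparse by linarith
  have c2: "card V2 = card V - card V1"
    unfolding V2_def using V1V fV by (meson card_Diff_subset finite_subset)
  have "bisection V V1 V2"
    unfolding bisection_def using c1 c2 V1V unfolding V2_def by (auto simp: of_nat_diff)
  moreover have "spanned_edges E V1 \<subseteq> spanned_edges E W1"
  proof -
    have "e \<subseteq> W1" if "e \<in> E" "e \<subseteq> V1" for e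
    proof -
      have "e \<subseteq> U" unfolding U_def using that(1) by blast
      then show ?thesis using that(2) I(1) unfolding V1_def A_def by blast
    qed
    then show ?thesis unfolding spanned_edges_def by blast
  qed
  moreover have "spanned_edges E V2 \<subseteq> spanned_edges E W2"
  proof -
    have "e \<subseteq> W2" if "e \<in> E" "e \<subseteq> V2" for e
    proof -
      have "e \<subseteq> U" unfolding U_def using that(1) by blast
      then show ?thesis using that(2) parts UV unfolding V2_def V1_def A_def by blast
    qed
    then show ?thesis unfolding spanned_edges_def by blast
  qed
  moreover have "finite (spanned_edges E W)" for W
    using fE unfolding spanned_edges_def by simp
  ultimately show ?thesis by (meson card_mono)
qed

section \<open>Constants and the cases by largest degree\<close>

text \<open>The second alternative asks for many edges as well as many vertices: a triangle with
  many isolated vertices meets the degree bound, but one side always spans an edge, which is too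
  much for \<open>\<epsilon> < 1/12\<close>.\<close>

theorem theorem1p7:
  fixes \<epsilon> :: real
  assumes "\<epsilon> > 0"
  shows "\<exists>N::nat. \<forall>(V :: 'a set) (E :: 'a set set) (n::nat) (m::nat).
    simple_graph V E \<and> card V = n \<and> card E = m \<and> n \<ge> N \<and>
    (real m \<ge> \<epsilon> powi (-2) * real n \<or>
     (\<forall>v\<in>V. real (vertex_degree E v) \<le> \<epsilon>\<^sup>2 * real n / 2) \<and> m \<ge> N) \<longrightarrow>
    (\<exists>V1 V2. bisection V V1 V2 \<and>
       real (card (spanned_edges E V1)) \<le> (1/4 + \<epsilon>) * real m \<and>
       real (card (spanned_edges E V2)) \<le> (1/4 + \<epsilon>) * real m)"
proof -
  \<comment> \<open>\<open>K\<close> bounds the number of subsets of the set of vertices of large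
    degree, hence the edges inside it; \<open>N\<close> makes \<open>K\<close> at most half of the
    allowed error \<open>\<epsilon> * m\<close>, and its \<open>+ 1\<close> gives
    \<open>m > 0\<close>.\<close>
  define K :: nat where "K = 2 ^ nat \<lfloor>2 / \<epsilon>\<rfloor>"
  define N :: nat where "N = nat \<lceil>2 * real K / \<epsilon>\<rceil> + 1"
  have "\<exists>V1 V2. bisection V V1 V2 \<and>
       real (card (spanned_edges E V1)) \<le> (1/4 + \<epsilon>) * real (card E) \<and>
       real (card (spanned_edges E V2)) \<le> (1/4 + \<epsilon>) * real (card E)"
    if G: "simple_graph V E"
      and hyp: "real (card E) \<ge> \<epsilon> powi (-2) * real (card V) \<or>
        (\<forall>v\<in>V. real (vertex_degree E v) \<le> \<epsilon>\<^sup>2 * real (card V) / 2) \<and> card E \<ge> N"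
    for V :: "'a set" and E :: "'a set set"
  proof -
    let ?m = "real (card E)" and ?n = "real (card V)"
    have fE: "finite E" using G by (rule simple_graph_finite_edges)
    have fV: "finite V" using G unfolding simple_graph_def by auto
    \<comment> \<open>The factor 4 turns the error \<open>M / 4\<close> of the bisection for bounded
      degrees into exactly \<open>\<epsilon> * ?m\<close>.\<close>
    consider "\<epsilon> \<ge> 1" | "\<forall>v\<in>V. real (vertex_degree E v) \<le> 4 * \<epsilon> * ?m"
      | "\<epsilon> < 1" "\<not> (\<forall>v\<in>V. real (vertex_degree E v) \<le> 4 * \<epsilon> * ?m)" by linarith
    then show ?thesis
    proof cases
      case 1
      \<comment> \<open>Any bisection will do, since the bound is at least
        \<open>?m\<close>.\<close>
      obtain V1 V2 where "bisection V V1 V2"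
        using bisection_of_max_degree[OF G, of ?n] vertex_degree_le_card[OF G] by auto
      moreover have "real (card (spanned_edges E W)) \<le> (1/4 + \<epsilon>) * ?m" for W
      proof -
        have "card (spanned_edges E W) \<le> card E"
          unfolding spanned_edges_def using fE by (intro card_mono) auto
        moreover have "1 * ?m \<le> (1/4 + \<epsilon>) * ?m" using 1 by (intro mult_right_mono) auto
        ultimately show ?thesis by linarith
      qed
      ultimately show ?thesis by blast
    next
      case 2
      then show ?thesis
        using bisection_of_max_degree[OF G, of "4 * \<epsilon> * ?m"] \<open>\<epsilon> > 0\<close> by (simp add: algebra_simps)
    next
      case 3
      then obtain v where v: "v \<in> V" "4 * \<epsilon> * ?m < real (vertex_degree E v)" by force
      \<comment> \<open>Hypothesis (i) would make \<open>?n\<close>, and with it every degree, at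
        most \<open>4 * \<epsilon> * ?m\<close>.\<close>
      have "\<not> (?m \<ge> \<epsilon> powi (-2) * ?n)"
      proof
        assume "?m \<ge> \<epsilon> powi (-2) * ?n"
        then have "?n \<le> \<epsilon>\<^sup>2 * ?m"
          using \<open>\<epsilon> > 0\<close> by (simp add: power_int_minus field_simps)
        also have "\<dots> \<le> 4 * \<epsilon> * ?m"
          using \<open>\<epsilon> > 0\<close> \<open>\<epsilon> < 1\<close> by (intro mult_right_mono) (auto simp: power2_eq_square)
        finally show False using v(2) vertex_degree_le_card[OF G, of v] by linarith
      qed
      then have deg: "real (vertex_degree E v) \<le> \<epsilon>\<^sup>2 * ?n / 2" and mN: "card E \<ge> N"
        using hyp v(1) by auto
      have "\<epsilon> * (8 * ?m) < \<epsilon> * (\<epsilon> * ?n)" using v(2) deg by (simp add: power2_eq_square)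
      then have "8 * ?m < \<epsilon> * ?n" using \<open>\<epsilon> > 0\<close> by simp
      also have "\<epsilon> * ?n \<le> ?n" using \<open>\<epsilon> < 1\<close> by (simp add: mult_left_le_one_le \<open>\<epsilon> > 0\<close> less_imp_le)
      finally have sparse: "4 * card E \<le> card V" by linarith
      have m: "0 < card E" "2 * real K / \<epsilon> \<le> ?m" using mN unfolding N_def by linarith+
      \<comment> \<open>With this threshold the rounding error is
        \<open>\<epsilon> * ?m / 2\<close>; the other half of the allowance pays for the edges
        inside \<open>H\<close>.\<close>
      define H where "H = {v \<in> V. \<epsilon> * ?m < real (vertex_degree E v)}"
      have "finite H" "H \<subseteq> V" using fV unfolding H_def by auto
      have "card H \<le> nat \<lfloor>2 / \<epsilon>\<rfloor>"
        using card_large_degree[OF G \<open>\<epsilon> > 0\<close> m(1)] unfolding H_def by linarith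
      then have "card (Pow H) \<le> K"
        unfolding K_def card_Pow[OF \<open>finite H\<close>] by (simp add: power_increasing)
      moreover have "card (spanned_edges E H) \<le> card (Pow H)"
        unfolding spanned_edges_def using \<open>finite H\<close> by (intro card_mono) auto
      ultimately have "real (card (spanned_edges E H)) \<le> real K" by simp
      also have "\<dots> \<le> \<epsilon> * ?m / 2" using m(2) \<open>\<epsilon> > 0\<close> by (simp add: field_simps)
      finally have kH: "real (card (spanned_edges E H)) \<le> \<epsilon> * ?m / 2" .
      obtain W1 W2 where W: "W1 \<union> W2 = V" "W1 \<inter> W2 = {}"
        "real (card (spanned_edges E W1)) \<le> ?m / 4 + card (spanned_edges E H) + \<epsilon> * ?m / 2"
        "real (card (spanned_edges E W2)) \<le> ?m / 4 + card (spanned_edges E H) + \<epsilon> * ?m / 2"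
        using partition_with_bounded_degree_outside[OF G \<open>H \<subseteq> V\<close>, of "\<epsilon> * ?m"] \<open>\<epsilon> > 0\<close>
        unfolding H_def by force
      obtain V1 V2 where V: "bisection V V1 V2"
        "card (spanned_edges E V1) \<le> card (spanned_edges E W1)"
        "card (spanned_edges E V2) \<le> card (spanned_edges E W2)"
        using bisection_of_sparse[OF G sparse W(1,2)] by blast
      have "?m / 4 + \<epsilon> * ?m / 2 + \<epsilon> * ?m / 2 = (1/4 + \<epsilon>) * ?m" by (simp add: algebra_simps)
      then have "real (card (spanned_edges E V1)) \<le> (1/4 + \<epsilon>) * ?m"
        "real (card (spanned_edges E V2)) \<le> (1/4 + \<epsilon>) * ?m"
        using V(2,3) W(3,4) kH by linarith+
      then show ?thesis using V(1) by blast
    qed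
  qed
  then show ?thesis by (intro exI[of _ N]) blast
qed

end
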